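(* Let $d,r$ be positive integers and let $P\subset\mathbb R^d$ be a set of $T(d,r)=(r-1)(d+1)+1$ points in stair-general position. Then $P$ has exactly $\bigl((r-1)!\bigr)^d$ stair-Tverberg partitions.
   Context: Stair-paths. For $a,b\in\mathbb R^d$ the stair-path $\sigma(a,b)$ is defined by induction on $d$. For $d=1$ it is the segment $ab$. For $d\ge2$, after possibly interchanging $a$ and $b$ assume $a_d\le b_d$; put $a'=(a_1,\dots,a_{d-1},b_d)$ and let $\sigma(a,b)$ be the union of the segment $aa'$ and the stair-path $\sigma(a',b)$, the latter being defined recursively in dimension $d-1$, ignoring the common last coordinate of $a'$ and $b$. A set $S\subseteq\mathbb R^d$ is stair-convex if $\sigma(a,b)\subseteq S$ for all $a,b\in S$. The stair-convex hull $\mathrm{stconv}(S)$ is the intersection of all stair-convex sets containing $S$. A set $S\subseteq\mathbb R^d$ is in stair-general position if $p_i\ne q_i$ for every two distinct points $p,q\in S$ and every $1\le i\le d$. A stair-Tverberg partition of a set $P\subset\mathbb R^d$ of size $T(d,r)$ in stair-general position is an (unordered) partition of $P$ into $r$ nonempty parts $P_1,\dots,P_r$ such that $\bigcap_{i=1}^r\mathrm{stconv}(P_i)\neq\emptyset$. *)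

theory Defs
  imports Complex_Main "HOL-Library.FuncSet" "HOL-Library.Disjoint_Sets"
begin

text \<open>
  The stair-path is defined by recursion on the dimension, so the dimension is a natural number
  and not a type: a point of d-dimensional real space is a function with coordinates indexed by
  1, ..., d and the fixed value \<open>undefined\<close> at all other indices.
\<close>

type_synonym point = "nat \<Rightarrow> real"

definition Rspace :: "nat \<Rightarrow> point set" where
  "Rspace d = {1..d} \<rightarrow>\<^sub>E UNIV"

definition seg :: "nat \<Rightarrow> point \<Rightarrow> point \<Rightarrow> point set" where
  "seg d a b = {(\<lambda>i\<in>{1..d}. (1 - t) * a i + t * b i) | t. 0 \<le> t \<and> t \<le> 1}"

text \<open>
  In the third equation, \<open>p\<close> and \<open>q\<close> are the points \<open>a\<close> and \<open>b\<close> after the possible interchange.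
  Ignoring the common last coordinate means dropping it by \<^const>\<open>restrict\<close>, and then putting it
  back in every point of the lower-dimensional path. Dimension 0 plays no role.
\<close>

fun stair_path :: "nat \<Rightarrow> point \<Rightarrow> point \<Rightarrow> point set" where
  "stair_path 0 a b = seg 0 a b"
| "stair_path (Suc 0) a b = seg 1 a b"
| "stair_path (Suc (Suc n)) a b =
    (let d = Suc (Suc n);
         (p, q) = (if a d \<le> b d then (a, b) else (b, a));
         p' = p(d := q d)
     in seg d p p' \<union>
        (\<lambda>x. x(d := q d)) ` stair_path (Suc n) (restrict p' {1..Suc n}) (restrict q {1..Suc n}))"

definition stair_convex :: "nat \<Rightarrow> point set \<Rightarrow> bool" where
  "stair_convex d S \<longleftrightarrow> S \<subseteq> Rspace d \<and> (\<forall>a\<in>S. \<forall>b\<in>S. stair_path d a b \<subseteq> S)"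

definition stconv :: "nat \<Rightarrow> point set \<Rightarrow> point set" where
  "stconv d S = \<Inter> {C. stair_convex d C \<and> S \<subseteq> C}"

definition stair_general_position :: "nat \<Rightarrow> point set \<Rightarrow> bool" where
  "stair_general_position d S \<longleftrightarrow>
     (\<forall>p\<in>S. \<forall>q\<in>S. p \<noteq> q \<longrightarrow> (\<forall>i\<in>{1..d}. p i \<noteq> q i))"

text \<open>
  The number of points and the stair-general position of \<open>P\<close> are not part of this definition;
  they are hypotheses on \<open>P\<close> wherever it is used.
\<close>

definition stair_Tverberg_partition :: "nat \<Rightarrow> nat \<Rightarrow> point set \<Rightarrow> point set set \<Rightarrow> bool" where
  "stair_Tverberg_partition d r P Q \<longleftrightarrow>
     partition_on P Q \<and> card Q = r \<and> (\<Inter>A\<in>Q. stconv d A) \<noteq> {}"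

end

theory Submission
  imports Defs
begin

text \<open>
  A point \<open>x\<close> lies in the stair-convex hull of \<open>S\<close> iff for every \<open>j \<le> d\<close> some \<open>a \<in> S\<close> has type \<open>j\<close>
  with respect to \<open>x\<close>: \<open>x\<^sub>j \<le> a\<^sub>j\<close> and \<open>a\<^sub>i \<le> x\<^sub>i\<close> for all \<open>i > j\<close>, where the first condition is void
  for \<open>j = 0\<close>. If \<open>x\<close> is common to the hulls of \<open>r\<close> parts, then counting forces \<open>x\<^sub>d\<close> to be the \<open>r\<close>-th
  largest last coordinate, say that of \<open>q\<close>. The points weakly below \<open>q\<close> are in number \<open>T(d-1,r)\<close>,
  and a partition is stair-Tverberg iff it induces a stair-Tverberg partition in dimension \<open>d-1\<close> on
  them and every part contains exactly one of the \<open>r\<close> points weakly above \<open>q\<close>. As \<open>q\<close> is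
  already placed, the other \<open>r-1\<close> of these points can be placed in \<open>(r-1)!\<close> ways.
\<close>

section \<open>Stair-convex hulls\<close>

definition stair_type :: "nat \<Rightarrow> nat \<Rightarrow> point \<Rightarrow> point \<Rightarrow> bool" where
  "stair_type d j a x \<longleftrightarrow> (j = 0 \<or> x j \<le> a j) \<and> (\<forall>i\<in>{j<..d}. a i \<le> x i)"

definition all_types :: "nat \<Rightarrow> point set \<Rightarrow> point \<Rightarrow> bool" where
  "all_types d A x \<longleftrightarrow> (\<forall>j\<le>d. \<exists>a\<in>A. stair_type d j a x)"

text \<open>Only coordinates \<open>1\<close> to \<open>d\<close> enter, so one function
  \<open>x\<close> can serve in several dimensions without being restricted.\<close>

lemma all_types_cong:
  assumes "\<And>i. i \<in> {1..d} \<Longrightarrow> x i = y i"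
  shows "all_types d A x \<longleftrightarrow> all_types d A y"
proof -
  have "stair_type d j a x \<longleftrightarrow> stair_type d j a y" if "j \<le> d" for j a
    using assms that by (cases "j = 0") (auto simp: stair_type_def)
  then show ?thesis by (auto simp: all_types_def)
qed

lemma all_types_nonempty: "all_types d A x \<Longrightarrow> A \<noteq> {}"
  by (auto simp: all_types_def)

text \<open>Type \<open>Suc d\<close> tests the last coordinate alone, and every smaller type splits
  off its condition on that coordinate. The inductions on hulls and on counting use this
  recursion.\<close>

lemma all_types_Suc:
  "all_types (Suc d) A x \<longleftrightarrow>
     (\<exists>a\<in>A. x (Suc d) \<le> a (Suc d)) \<and> all_types d {a\<in>A. a (Suc d) \<le> x (Suc d)} x"
proof -
  have top: "stair_type (Suc d) (Suc d) a x \<longleftrightarrow> x (Suc d) \<le> a (Suc d)" for a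
    by (auto simp: stair_type_def)
  have low: "stair_type (Suc d) j a x \<longleftrightarrow> a (Suc d) \<le> x (Suc d) \<and> stair_type d j a x"
    if "j \<le> d" for j a
  proof -
    have "{j<..Suc d} = insert (Suc d) {j<..d}" using that by auto
    then show ?thesis by (auto simp: stair_type_def)
  qed
  have "{..Suc d} = insert (Suc d) {..d}" by auto
  then have "all_types (Suc d) A x \<longleftrightarrow> (\<exists>a\<in>A. stair_type (Suc d) (Suc d) a x) \<and>
      (\<forall>j\<le>d. \<exists>a\<in>A. stair_type (Suc d) j a x)"
    unfolding all_types_def by (metis le_Suc_eq)
  also have "\<dots> \<longleftrightarrow> (\<exists>a\<in>A. x (Suc d) \<le> a (Suc d)) \<and>
      (\<forall>j\<le>d. \<exists>a\<in>A. a (Suc d) \<le> x (Suc d) \<and> stair_type d j a x)"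
    using top low by auto
  finally show ?thesis by (auto simp: all_types_def)
qed

lemma all_types_mono: "all_types d A x \<Longrightarrow> A \<subseteq> B \<Longrightarrow> all_types d B x"
  unfolding all_types_def by blast

text \<open>Inequalities for the same \<open>j\<close> compose, so collecting all points that see
  every type in a set acts as a closure operator.\<close>

lemma all_types_trans:
  assumes "\<And>a. a \<in> A \<Longrightarrow> all_types d B a" and "all_types d A x"
  shows "all_types d B x"
  unfolding all_types_def
proof (intro allI impI)
  fix j assume j: "j \<le> d"
  with assms(2) obtain a where a: "a \<in> A" "stair_type d j a x" by (auto simp: all_types_def)
  with assms(1) j obtain b where "b \<in> B" "stair_type d j b a" by (force simp: all_types_def)
  moreover from this a have "stair_type d j b x"
    unfolding stair_type_def by (meson order_trans)
  ultimately show "\<exists>b\<in>B. stair_type d j b x" by blast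
qed

lemma all_types_refl: "a \<in> A \<Longrightarrow> all_types d A a"
  by (auto simp: all_types_def stair_type_def)

section \<open>Stair-paths\<close>

lemma seg_commute: "seg d a b = seg d b a"
proof -
  have "seg d a b \<subseteq> seg d b a" for a b
  proof
    fix x assume "x \<in> seg d a b"
    then obtain t where t: "x = (\<lambda>i\<in>{1..d}. (1 - t) * a i + t * b i)" "0 \<le> t" "t \<le> 1"
      by (auto simp: seg_def)
    have "x = (\<lambda>i\<in>{1..d}. (1 - (1 - t)) * b i + (1 - t) * a i)"
      unfolding t by (auto simp: restrict_def fun_eq_iff)
    with t show "x \<in> seg d b a" unfolding seg_def by (intro CollectI exI[of _ "1 - t"]) auto
  qed
  then show ?thesis by blast
qed

definition up_path :: "nat \<Rightarrow> point \<Rightarrow> point \<Rightarrow> point set" where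
  "up_path n p q = (let p' = p(Suc n := q (Suc n)) in
     seg (Suc n) p p' \<union>
     (\<lambda>x. x(Suc n := q (Suc n))) ` stair_path n (restrict p' {1..n}) (restrict q {1..n}))"

text \<open>A recursion that also covers dimension 1: there the path of dimension 0 is the single
  function that is \<open>undefined\<close> everywhere, and lifting it yields the endpoint
  \<open>q\<close> of the segment.\<close>

lemma stair_path_Suc:
  "stair_path (Suc n) a b = (if a (Suc n) \<le> b (Suc n) then up_path n a b else up_path n b a)"
proof (cases n)
  case 0
  have "up_path 0 p q = seg 1 p q" for p q
  proof -
    have eq: "seg (Suc 0) p (p(Suc 0 := q (Suc 0))) = seg 1 p q"
    proof -
      have "(\<lambda>i\<in>{1..Suc 0}. (1 - t) * p i + t * (p(Suc 0 := q (Suc 0))) i) =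
          (\<lambda>i\<in>{1..1}. (1 - t) * p i + t * q i)" for t
        by (auto simp: fun_eq_iff)
      then show ?thesis unfolding seg_def by simp
    qed
    \<comment> \<open>The parameter 1 gives the endpoint \<open>q\<close>.\<close>
    have "(\<lambda>i\<in>{1..1}. (1 - 1) * p i + 1 * q i) \<in> seg 1 p q"
      unfolding seg_def by (intro CollectI exI[of _ 1]) auto
    also have "(\<lambda>i\<in>{1..1}. (1 - 1) * p i + 1 * q i) = (\<lambda>i. undefined)(Suc 0 := q (Suc 0))"
      by (auto simp: fun_eq_iff)
    finally have mem: "(\<lambda>i. undefined)(Suc 0 := q (Suc 0)) \<in> seg 1 p q" .
    have "(\<lambda>x. x(Suc 0 := q (Suc 0))) ` stair_path 0 a b \<subseteq> seg 1 p q" for a b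
    proof (rule image_subsetI)
      fix x assume "x \<in> stair_path 0 a b"
      then have "x = (\<lambda>i. undefined)" by (auto simp: seg_def fun_eq_iff)
      then show "x(Suc 0 := q (Suc 0)) \<in> seg 1 p q" using mem by simp
    qed
    then have "(\<lambda>x. x(Suc 0 := q (Suc 0))) `
        stair_path 0 (restrict (p(Suc 0 := q (Suc 0))) {1..0}) (restrict q {1..0}) \<subseteq> seg 1 p q"
      by blast
    then show ?thesis unfolding up_path_def Let_def eq by blast
  qed
  then show ?thesis using 0 seg_commute[of 1 a b] by simp
next
  case (Suc m)
  then show ?thesis by (simp add: up_path_def Let_def)
qed

lemma stair_path_in_Rspace: "stair_path d a b \<subseteq> Rspace d"
proof (induction d arbitrary: a b)
  case 0
  then show ?case by (auto simp: seg_def Rspace_def)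
next
  case (Suc d)
  have "seg (Suc d) p q \<subseteq> Rspace (Suc d)" for p q
    by (auto simp: seg_def Rspace_def)
  moreover have "x(Suc d := c) \<in> Rspace (Suc d)" if "x \<in> Rspace d" for x c
    using that by (auto simp: Rspace_def PiE_def extensional_def)
  ultimately have "up_path d p q \<subseteq> Rspace (Suc d)" for p q
    using Suc.IH unfolding up_path_def Let_def by blast
  then show ?case using stair_path_Suc by simp
qed

text \<open>On the vertical piece the lower endpoint supplies all types up to \<open>d\<close> and
  the upper one the type \<open>Suc d\<close>. On the remaining piece both endpoints are weakly
  below, and induction applies.\<close>

lemma all_types_stair_path: "x \<in> stair_path d a b \<Longrightarrow> all_types d {a, b} x"
proof (induction d arbitrary: a b x)
  case 0
  then show ?case by (auto simp: all_types_def stair_type_def)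
next
  case (Suc d)
  have up: "all_types (Suc d) {p, q} x" if x: "x \<in> up_path d p q" and le: "p (Suc d) \<le> q (Suc d)" for p q
  proof -
    define p' where "p' = p(Suc d := q (Suc d))"
    from x consider "x \<in> seg (Suc d) p p'"
      | y where "y \<in> stair_path d (restrict p' {1..d}) (restrict q {1..d})" "x = y(Suc d := q (Suc d))"
      unfolding up_path_def Let_def p'_def by blast
    then show ?thesis
    proof cases
      case 1
      then obtain t where t: "x = (\<lambda>i\<in>{1..Suc d}. (1 - t) * p i + t * p' i)" "0 \<le> t" "t \<le> 1"
        by (auto simp: seg_def)
      have xi: "x i = p i" if "i \<in> {1..d}" for i
        using that by (simp add: t p'_def algebra_simps)
      have last: "x (Suc d) = (1 - t) * p (Suc d) + t * q (Suc d)"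
        by (simp add: t p'_def)
      \<comment> \<open>The difference of the two sides is \<open>t\<close> times the height of the
        segment.\<close>
      have "p (Suc d) \<le> x (Suc d)"
        using mult_nonneg_nonneg[of t "q (Suc d) - p (Suc d)"] t(2,3) le by (simp add: last algebra_simps)
      moreover have "x (Suc d) \<le> q (Suc d)"
        using mult_nonneg_nonneg[of "1 - t" "q (Suc d) - p (Suc d)"] t(2,3) le by (simp add: last algebra_simps)
      moreover have "all_types d {p} x"
        using all_types_refl[of p "{p}" d] all_types_cong[of d x p "{p}"] xi by auto
      ultimately show ?thesis
        unfolding all_types_Suc by (auto elim: all_types_mono)
    next
      case 2
      then have "all_types d {restrict p' {1..d}, restrict q {1..d}} y" using Suc.IH by blast
      then have "all_types d {restrict p' {1..d}, restrict q {1..d}} x"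
        using all_types_cong[of d x y] 2 by simp
      moreover have "all_types d {p, q} (restrict p' {1..d})"
        using all_types_refl[of p "{p, q}" d] all_types_cong[of d "restrict p' {1..d}" p]
        by (simp add: p'_def)
      moreover have "all_types d {p, q} (restrict q {1..d})"
        using all_types_refl[of q "{p, q}" d] all_types_cong[of d "restrict q {1..d}" q] by simp
      ultimately have "all_types d {p, q} x"
        by (intro all_types_trans[of "{restrict p' {1..d}, restrict q {1..d}}" d "{p, q}" x]) auto
      then show ?thesis
        unfolding all_types_Suc using le 2 by (auto elim!: all_types_mono)
    qed
  qed
  show ?case
  proof (cases "a (Suc d) \<le> b (Suc d)")
    case True
    then show ?thesis using Suc.prems up[of a b] by (simp only: stair_path_Suc if_True)
  next
    case False
    then show ?thesis using Suc.prems up[of b a]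
      by (simp only: stair_path_Suc if_False) (simp add: insert_commute)
  qed
qed

section \<open>The hull in terms of types\<close>

text \<open>Between points of equal last coordinate the vertical piece degenerates, so the
  stair-path contains the lifted path of dimension \<open>d\<close>.\<close>

lemma stair_convex_slice:
  assumes C: "stair_convex (Suc d) C"
  shows "stair_convex d ((\<lambda>y. restrict y {1..d}) ` {y\<in>C. y (Suc d) = h})" (is "stair_convex d ?D")
  unfolding stair_convex_def
proof (intro conjI ballI)
  show "?D \<subseteq> Rspace d" by (auto simp: Rspace_def)
next
  fix a' b' assume "a' \<in> ?D" "b' \<in> ?D"
  then obtain a b where ab: "a \<in> C" "a (Suc d) = h" "a' = restrict a {1..d}"
      "b \<in> C" "b (Suc d) = h" "b' = restrict b {1..d}" by auto
  have "a(Suc d := h) = a" using ab by auto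
  with ab have "(\<lambda>x. x(Suc d := h)) ` stair_path d a' b' \<subseteq> stair_path (Suc d) a b"
    by (simp add: stair_path_Suc up_path_def)
  also have "\<dots> \<subseteq> C" using C ab by (auto simp: stair_convex_def)
  finally have sub: "(\<lambda>x. x(Suc d := h)) ` stair_path d a' b' \<subseteq> C" .
  show "stair_path d a' b' \<subseteq> ?D"
  proof
    fix x assume x: "x \<in> stair_path d a' b'"
    then have "restrict (x(Suc d := h)) {1..d} = x"
      using stair_path_in_Rspace by (fastforce simp: Rspace_def PiE_def extensional_def fun_eq_iff)
    then show "x \<in> ?D" using x sub by (intro image_eqI[of _ _ "x(Suc d := h)"]) auto
  qed
qed

lemma vertical_seg_subset:
  assumes C: "stair_convex (Suc d) C" and ab: "a \<in> C" "b \<in> C" and h: "a (Suc d) \<le> h" "h \<le> b (Suc d)"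
  shows "a(Suc d := h) \<in> C"
proof -
  \<comment> \<open>The parameter at which the vertical segment reaches height \<open>h\<close>; if
    both ends have equal height, then \<open>h\<close> is that height and 0 works.\<close>
  define t where "t = (if a (Suc d) = b (Suc d) then 0 else (h - a (Suc d)) / (b (Suc d) - a (Suc d)))"
  have t: "0 \<le> t" "t \<le> 1" using h by (auto simp: t_def field_simps)
  have ht: "h = (1 - t) * a (Suc d) + t * b (Suc d)"
  proof (cases "a (Suc d) = b (Suc d)")
    case False
    then have "t * (b (Suc d) - a (Suc d)) = h - a (Suc d)" by (simp add: t_def)
    then show ?thesis by (simp add: algebra_simps)
  qed (use h in \<open>auto simp: t_def\<close>)
  have "a \<in> Rspace (Suc d)" using C ab by (auto simp: stair_convex_def)
  then have "a(Suc d := h) = (\<lambda>i\<in>{1..Suc d}. (1 - t) * a i + t * (a(Suc d := b (Suc d))) i)"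
    using ht by (auto simp: fun_eq_iff Rspace_def PiE_def extensional_def algebra_simps)
  then have "a(Suc d := h) \<in> seg (Suc d) a (a(Suc d := b (Suc d)))"
    using t by (auto simp: seg_def)
  then have "a(Suc d := h) \<in> stair_path (Suc d) a b"
    using h by (simp add: stair_path_Suc up_path_def Let_def)
  then show ?thesis using C ab by (auto simp: stair_convex_def)
qed

text \<open>All points weakly below the height of \<open>x\<close> are raised vertically to that
  height, where a point of type \<open>Suc d\<close> guarantees that they stay in \<open>C\<close>.
  The slice there is stair-convex, and induction finds \<open>x\<close> in it.\<close>

lemma stair_convex_all_types:
  assumes "stair_convex d C" "all_types d C x" "x \<in> Rspace d"
  shows "x \<in> C"
  using assms
proof (induction d arbitrary: C x)
  case 0
  then obtain a where "a \<in> C" by (auto simp: all_types_def)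
  moreover from this 0 have "a \<in> Rspace 0" by (auto simp: stair_convex_def)
  ultimately show ?case using 0 by (simp add: Rspace_def)
next
  case (Suc d)
  define h where "h = x (Suc d)"
  define D where "D = (\<lambda>y. restrict y {1..d}) ` {y\<in>C. y (Suc d) = h}"
  from Suc.prems(2) obtain b where b: "b \<in> C" "h \<le> b (Suc d)"
    and lower: "all_types d {a\<in>C. a (Suc d) \<le> h} x"
    by (auto simp: all_types_Suc h_def)
  have "all_types d D a" if "a \<in> C" "a (Suc d) \<le> h" for a
  proof -
    have "a(Suc d := h) \<in> {y\<in>C. y (Suc d) = h}"
      using vertical_seg_subset[OF Suc.prems(1) that(1) b(1) that(2) b(2)] by simp
    then have "restrict (a(Suc d := h)) {1..d} \<in> D" unfolding D_def by (rule imageI)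
    then have "all_types d D (restrict (a(Suc d := h)) {1..d})" by (rule all_types_refl)
    then show ?thesis using all_types_cong[of d a "restrict (a(Suc d := h)) {1..d}"] by simp
  qed
  \<comment> \<open>The raised points have the same first \<open>d\<close> coordinates as the
    original ones, so they provide the same types.\<close>
  then have "all_types d D x" by (intro all_types_trans[OF _ lower]) auto
  then have "all_types d D (restrict x {1..d})" using all_types_cong[of d x "restrict x {1..d}"] by simp
  moreover have "stair_convex d D" unfolding D_def by (rule stair_convex_slice[OF Suc.prems(1)])
  moreover have "restrict x {1..d} \<in> Rspace d" by (simp add: Rspace_def)
  ultimately have "restrict x {1..d} \<in> D" using Suc.IH by blast
  then obtain y where y: "y \<in> C" "y (Suc d) = x (Suc d)" "restrict x {1..d} = restrict y {1..d}"
    by (auto simp: D_def h_def)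
  have "y \<in> Rspace (Suc d)" using y Suc.prems by (auto simp: stair_convex_def)
  moreover have "x i = y i" if "i \<in> {1..Suc d}" for i
  proof (cases "i = Suc d")
    case False
    then show ?thesis using fun_cong[OF y(3), of i] that by auto
  qed (use y in simp)
  ultimately have "x = y"
    using Suc.prems(3) unfolding Rspace_def by (meson PiE_ext)
  then show ?case using y by simp
qed

text \<open>The right-hand side is itself a stair-convex set containing \<open>S\<close>, and by the
  previous lemma it lies in every other such set.\<close>

lemma stconv_iff:
  assumes "S \<subseteq> Rspace d"
  shows "x \<in> stconv d S \<longleftrightarrow> x \<in> Rspace d \<and> all_types d S x"
proof
  let ?C = "{x \<in> Rspace d. all_types d S x}"
  have "stair_convex d ?C"
    unfolding stair_convex_def
  proof (intro conjI ballI subsetI)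
    fix a b y assume "a \<in> ?C" "b \<in> ?C" "y \<in> stair_path d a b"
    then show "y \<in> ?C"
      using stair_path_in_Rspace all_types_trans[OF _ all_types_stair_path[of y d a b], of S] by blast
  qed auto
  moreover have "S \<subseteq> ?C" using assms all_types_refl by blast
  ultimately show "x \<in> stconv d S \<Longrightarrow> x \<in> Rspace d \<and> all_types d S x"
    unfolding stconv_def by blast
next
  show "x \<in> Rspace d \<and> all_types d S x \<Longrightarrow> x \<in> stconv d S"
    unfolding stconv_def using stair_convex_all_types all_types_mono by blast
qed

definition common_all_types :: "nat \<Rightarrow> point set set \<Rightarrow> bool" where
  "common_all_types d Q \<longleftrightarrow> (\<exists>x. \<forall>A\<in>Q. all_types d A x)"

lemma stair_Tverberg_partition_iff:
  assumes "P \<subseteq> Rspace d"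
  shows "stair_Tverberg_partition d r P Q \<longleftrightarrow>
    partition_on P Q \<and> card Q = r \<and> common_all_types d Q"
proof -
  have "(\<Inter>A\<in>Q. stconv d A) \<noteq> {} \<longleftrightarrow> common_all_types d Q" if "partition_on P Q"
  proof -
    have st: "x \<in> stconv d A \<longleftrightarrow> x \<in> Rspace d \<and> all_types d A x" if "A \<in> Q" for A x
      using \<open>partition_on P Q\<close> that assms by (intro stconv_iff) (auto simp: partition_on_def)
    show ?thesis
    proof
      assume "(\<Inter>A\<in>Q. stconv d A) \<noteq> {}"
      then show "common_all_types d Q" unfolding common_all_types_def using st by blast
    next
      assume "common_all_types d Q"
      then obtain x where "\<forall>A\<in>Q. all_types d A x" by (auto simp: common_all_types_def)
      then have "\<forall>A\<in>Q. all_types d A (restrict x {1..d})"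
        using all_types_cong[of d x "restrict x {1..d}"] by simp
      then have "restrict x {1..d} \<in> (\<Inter>A\<in>Q. stconv d A)"
        using st by (auto simp: Rspace_def)
      then show "(\<Inter>A\<in>Q. stconv d A) \<noteq> {}" by blast
    qed
  qed
  then show ?thesis unfolding stair_Tverberg_partition_def by blast
qed

section \<open>Partitions and their traces\<close>

lemma partition_on_part_unique:
  "partition_on P Q \<Longrightarrow> A \<in> Q \<Longrightarrow> B \<in> Q \<Longrightarrow> u \<in> A \<Longrightarrow> u \<in> B \<Longrightarrow> A = B"
  by (auto simp: partition_on_def disjoint_def)

text \<open>As no trace is empty, disjointness keeps the traces of different parts different; hence
  the number of parts survives.\<close>

lemma partition_on_trace:
  assumes Q: "partition_on P Q" and "L \<subseteq> P" and ne: "\<And>A. A \<in> Q \<Longrightarrow> L \<inter> A \<noteq> {}"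
  shows "partition_on L ((\<inter>) L ` Q)" and "inj_on ((\<inter>) L) Q"
proof -
  have "(\<inter>) L ` Q - {{}} = (\<inter>) L ` Q" using ne by auto
  moreover have "L \<inter> P = L" using assms by auto
  ultimately show "partition_on L ((\<inter>) L ` Q)" using partition_on_restrict[OF Q, of L] by simp
  show "inj_on ((\<inter>) L) Q"
  proof (rule inj_onI)
    fix A B assume AB: "A \<in> Q" "B \<in> Q" "L \<inter> A = L \<inter> B"
    then obtain u where "u \<in> A" "u \<in> B" using ne by blast
    then show "A = B" using partition_on_part_unique[OF Q] AB by blast
  qed
qed

section \<open>Counting the extensions of a partition\<close>

text \<open>Choosing a point of \<open>U\<close> in each part is injective, since parts are
  disjoint.\<close>

lemma card_le_of_hits:
  assumes Q: "partition_on P Q" and "finite U" and "\<And>A. A \<in> Q \<Longrightarrow> U \<inter> A \<noteq> {}"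
  shows "card Q \<le> card U"
proof -
  have "\<forall>A\<in>Q. \<exists>u. u \<in> U \<inter> A" using assms(3) by blast
  then obtain f where f: "\<And>A. A \<in> Q \<Longrightarrow> f A \<in> U \<inter> A" by metis
  then have "inj_on f Q" by (metis IntD2 inj_onI partition_on_part_unique[OF Q])
  then show ?thesis by (rule card_inj_on_le) (use f assms in auto)
qed

lemma card_inj_PiE:
  assumes "finite N" "finite M" "card N = card M"
  shows "card {g \<in> N \<rightarrow>\<^sub>E M. inj_on g N} = fact (card N)"
  using card_inj_on_subset_funcset[of N M N] assms by (simp add: fact_prod_rev)

text \<open>Each point of \<open>U\<close> other than \<open>q\<close> has to join a part of \<open>Q'\<close> that does not contain \<open>q\<close>,
  and distinct points have to join distinct parts.\<close>

lemma card_extensions_of_trace: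
  assumes U: "finite U" "card U = r" and UL: "U \<union> L = P" "U \<inter> L = {q}"
    and Q': "partition_on L Q'" "card Q' = r"
  shows "card {Q. partition_on P Q \<and> card Q = r \<and> (\<forall>A\<in>Q. U \<inter> A \<noteq> {}) \<and> (\<inter>) L ` Q = Q'}
    = fact (r - 1)" (is "card ?Fib = _")
proof -
  define N where "N = U - {q}"
  have q: "q \<in> U" "q \<in> L" using UL by auto
  have r: "r > 0" using U q by (metis card_gt_0_iff empty_iff)
  have finQ': "finite Q'" using r Q' by (metis card_gt_0_iff)
  obtain A0 where A0: "A0 \<in> Q'" "q \<in> A0" using q Q' by (auto simp: partition_on_def)
  define M where "M = Q' - {A0}"
  have cN: "finite N" "card N = r - 1" using U q by (auto simp: N_def)
  have cM: "finite M" "card M = r - 1" using A0 Q' finQ' by (auto simp: M_def)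
  have NL: "n \<notin> L" if "n \<in> N" for n using that UL by (auto simp: N_def)
  have Q'L: "A \<subseteq> L" if "A \<in> Q'" for A using Q' that by (auto simp: partition_on_def)
  \<comment> \<open>\<open>g\<close> tells which part each new point joins. The part
    \<open>A0\<close> receives none, as it already meets \<open>U\<close> in
    \<open>q\<close>.\<close>
  define join where "join g A = A \<union> {n\<in>N. g n = A}" for g :: "'a \<Rightarrow> 'a set" and A
  have join_trace: "L \<inter> join g A = A" if "A \<in> Q'" for g A
    using that Q'L NL by (auto simp: join_def)
  let ?I = "{g \<in> N \<rightarrow>\<^sub>E M. inj_on g N}"
  have "bij_betw (\<lambda>g. join g ` Q') ?I ?Fib"
    unfolding bij_betw_def
  proof
    show "inj_on (\<lambda>g. join g ` Q') ?I"
    proof (rule inj_onI)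
      fix g k assume gk: "g \<in> ?I" "k \<in> ?I" "join g ` Q' = join k ` Q'"
      show "g = k"
      proof (rule PiE_ext[of g N "\<lambda>_. M" k])
        fix n assume n: "n \<in> N"
        then have "g n \<in> Q'" using gk by (auto simp: M_def)
        moreover from this gk(3) obtain A where A: "A \<in> Q'" "join g (g n) = join k A" by blast
        moreover have "g n = A" using join_trace A calculation by metis
        moreover have "n \<in> join k A" using A n by (auto simp: join_def)
        ultimately show "g n = k n" using NL[OF n] Q'L by (auto simp: join_def)
      qed (use gk in auto)
    qed
    show "(\<lambda>g. join g ` Q') ` ?I = ?Fib"
    proof (intro equalityI subsetI)
      fix Q assume "Q \<in> (\<lambda>g. join g ` Q') ` ?I"
      then obtain g where g: "g \<in> N \<rightarrow>\<^sub>E M" "inj_on g N" and Q: "Q = join g ` Q'" by auto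
      \<comment> \<open>Equal sizes make the injection \<open>g\<close> surjective, so every part
        other than \<open>A0\<close> meets \<open>U\<close> as well.\<close>
      have gN: "g ` N = M"
        using g cN cM by (intro card_subset_eq) (auto simp: card_image)
      have "inj_on (join g) Q'" using join_trace by (metis inj_onI)
      then have "card Q = r" using Q Q' by (simp add: card_image)
      moreover have "(\<inter>) L ` Q = Q'" unfolding Q image_image using join_trace by simp
      moreover have "U \<inter> join g A \<noteq> {}" if "A \<in> Q'" for A
      proof (cases "A = A0")
        case True
        then show ?thesis using q A0 by (auto simp: join_def)
      next
        case False
        then have "A \<in> g ` N" using that gN by (auto simp: M_def)
        then show ?thesis by (auto simp: join_def N_def)
      qed
      moreover have "partition_on P Q"
      proof (rule partition_onI)
        have "\<Union> Q = L \<union> N"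
          using Q' g unfolding Q partition_on_def join_def M_def by blast
        then show "\<Union> Q = P" using UL by (auto simp: N_def)
        show "{} \<notin> Q" using Q Q' by (auto simp: join_def partition_on_def)
        fix B C assume BC: "B \<in> Q" "C \<in> Q" "B \<noteq> C"
        then obtain A D where AD: "A \<in> Q'" "D \<in> Q'" "B = join g A" "C = join g D" "A \<noteq> D"
          unfolding Q by blast
        then show "disjnt B C"
          using partition_on_part_unique[OF Q'(1), of A D] NL Q'L
          unfolding disjnt_iff join_def by blast
      qed
      ultimately show "Q \<in> ?Fib" unfolding Q by auto
    next
      fix Q assume "Q \<in> ?Fib"
      then have Q: "partition_on P Q" "card Q = r" "\<And>A. A \<in> Q \<Longrightarrow> U \<inter> A \<noteq> {}" "(\<inter>) L ` Q = Q'"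
        by auto
      have "{} \<notin> Q'" using Q' by (auto simp: partition_on_def)
      then have "L \<inter> A \<noteq> {}" if "A \<in> Q" for A using Q(4) that by (metis imageI)
      then have inj: "inj_on ((\<inter>) L) Q" using partition_on_trace[OF Q(1), of L] UL by blast
      have "\<forall>u\<in>U. \<exists>A\<in>Q. u \<in> A" using Q(1) UL by (auto simp: partition_on_def)
      then obtain h where h: "\<And>u. u \<in> U \<Longrightarrow> h u \<in> Q" "\<And>u. u \<in> U \<Longrightarrow> u \<in> h u" by metis
      have hu: "h u = A" if "u \<in> U" "A \<in> Q" "u \<in> A" for u A
        using partition_on_part_unique[OF Q(1)] h that by blast
      have "h ` U = Q"
      proof (intro equalityI subsetI)
        fix A assume "A \<in> Q"
        moreover from this obtain u where "u \<in> U" "u \<in> A" using Q(3) by blast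
        ultimately show "A \<in> h ` U" using hu by (metis image_eqI)
      qed (use h in auto)
      \<comment> \<open>\<open>h\<close> maps \<open>U\<close> onto the \<open>r\<close> parts and
        \<open>U\<close> has \<open>r\<close> points, so each part contains exactly one of
        them.\<close>
      then have inj_h: "inj_on h U" using eq_card_imp_inj_on[of U h] U Q by simp
      have LQ: "L \<inter> B \<in> Q'" if "B \<in> Q" for B using Q(4) that by blast
      have hq: "L \<inter> h q = A0"
        using partition_on_part_unique[OF Q'(1) LQ A0(1), of "h q" q] h q A0 by blast
      \<comment> \<open>The preimage of \<open>Q\<close>: each new point is sent to the trace of the
        part containing it.\<close>
      define g where "g = (\<lambda>n\<in>N. L \<inter> h n)"
      have "inj_on g N"
      proof (rule inj_onI)
        fix m n assume "m \<in> N" "n \<in> N" "g m = g n"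
        then show "m = n" using inj_onD[OF inj, of "h m" "h n"] inj_onD[OF inj_h, of m n] h
          by (auto simp: g_def N_def)
      qed
      moreover have "g n \<in> M" if n: "n \<in> N" for n
      proof -
        have "g n \<noteq> A0"
          using inj_onD[OF inj, of "h n" "h q"] inj_onD[OF inj_h, of n q] h hq q n
          by (auto simp: g_def N_def)
        then show ?thesis using LQ h n by (auto simp: M_def g_def N_def)
      qed
      ultimately have "g \<in> ?I" by (auto simp: g_def)
      moreover have "join g (L \<inter> B) = B" if B: "B \<in> Q" for B
      proof
        show "join g (L \<inter> B) \<subseteq> B"
        proof
          fix n assume "n \<in> join g (L \<inter> B)"
          then consider "n \<in> B" | "n \<in> N" "g n = L \<inter> B" unfolding join_def by blast
          then show "n \<in> B"
          proof cases
            case 2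
            have "h n = B"
            proof (rule inj_onD[OF inj])
              show "L \<inter> h n = L \<inter> B" using 2 by (simp add: g_def)
              show "h n \<in> Q" using h(1) 2(1) by (simp add: N_def)
            qed (rule B)
            moreover have "n \<in> h n" using h(2) 2(1) by (simp add: N_def)
            ultimately show ?thesis by simp
          qed
        qed
        show "B \<subseteq> join g (L \<inter> B)"
        proof
          fix n assume n: "n \<in> B"
          then have "n \<in> L \<or> n \<in> N" using B Q(1) UL q by (auto simp: partition_on_def N_def)
          then show "n \<in> join g (L \<inter> B)"
            using n hu[of n B] B by (cases "n \<in> L") (simp_all add: join_def g_def N_def)
        qed
      qed
      then have "join g ` Q' = Q" unfolding Q(4)[symmetric] image_image by simp
      ultimately show "Q \<in> (\<lambda>g. join g ` Q') ` ?I" by blast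
    qed
  qed
  then have "card ?Fib = card ?I" by (simp add: bij_betw_same_card)
  then show ?thesis using card_inj_PiE[of N M] cN cM by simp
qed

text \<open>The partitions are grouped by their trace on \<open>L\<close>; all fibres have the same
  size.\<close>

lemma card_extensions:
  assumes P: "finite P" and U: "card U = r" and UL: "U \<union> L = P" "U \<inter> L = {q}"
    and G: "G \<subseteq> {Q'. partition_on L Q' \<and> card Q' = r}"
  shows "card {Q. partition_on P Q \<and> card Q = r \<and> (\<forall>A\<in>Q. U \<inter> A \<noteq> {}) \<and> (\<inter>) L ` Q \<in> G}
    = card G * fact (r - 1)"
proof -
  let ?Fib = "\<lambda>Q'. {Q. partition_on P Q \<and> card Q = r \<and> (\<forall>A\<in>Q. U \<inter> A \<noteq> {}) \<and> (\<inter>) L ` Q = Q'}"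
  have fin: "finite {Q. partition_on R Q}" if "R \<subseteq> P" for R
    using finitely_many_partition_on[of R] that P by (auto dest: finite_subset)
  have "finite G" using fin[of L] G UL by (auto elim!: finite_subset[rotated])
  moreover have "finite (?Fib Q')" for Q'
    using fin[of P] by (auto elim!: finite_subset[rotated])
  ultimately have "card (\<Union>(?Fib ` G)) = (\<Sum>Q'\<in>G. card (?Fib Q'))"
    by (intro card_UN_disjoint) auto
  also have "\<dots> = (\<Sum>Q'\<in>G. fact (r - 1))"
    using card_extensions_of_trace[of U r L P q] P U UL G by (intro sum.cong) auto
  also have "\<Union>(?Fib ` G) = {Q. partition_on P Q \<and> card Q = r \<and> (\<forall>A\<in>Q. U \<inter> A \<noteq> {}) \<and> (\<inter>) L ` Q \<in> G}"
    by blast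
  finally show ?thesis by simp
qed

section \<open>Counting by induction on the dimension\<close>

lemma stair_general_position_mono:
  "stair_general_position d P \<Longrightarrow> e \<le> d \<Longrightarrow> R \<subseteq> P \<Longrightarrow> stair_general_position e R"
  unfolding stair_general_position_def by (meson atLeastAtMost_iff order_trans subsetD)

text \<open>The rank counted from the top is an injection of \<open>P\<close> into
  \<open>{1..card P}\<close>, hence onto.\<close>

lemma exists_rank:
  fixes c :: "'a \<Rightarrow> real"
  assumes P: "finite P" and inj: "inj_on c P" and r: "1 \<le> r" "r \<le> card P"
  obtains q where "q \<in> P" "card {p\<in>P. c q \<le> c p} = r"
proof -
  define rk where "rk q = card {p\<in>P. c q \<le> c p}" for q
  have less: "rk q < rk p" if "p \<in> P" "q \<in> P" "c p < c q" for p q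
  proof -
    have "{s\<in>P. c q \<le> c s} \<subseteq> {s\<in>P. c p \<le> c s}" using that by auto
    moreover have "p \<in> {s\<in>P. c p \<le> c s}" "p \<notin> {s\<in>P. c q \<le> c s}" using that by auto
    ultimately have "{s\<in>P. c q \<le> c s} \<subset> {s\<in>P. c p \<le> c s}" by blast
    then show ?thesis unfolding rk_def using P by (intro psubset_card_mono) auto
  qed
  have "inj_on rk P"
  proof (rule inj_onI)
    fix p q assume "p \<in> P" "q \<in> P" "rk p = rk q"
    then have "c p = c q" using less[of p q] less[of q p] by linarith
    then show "p = q" using inj \<open>p \<in> P\<close> \<open>q \<in> P\<close> by (auto dest: inj_onD)
  qed
  moreover have "rk ` P \<subseteq> {1..card P}"
  proof (intro image_subsetI)
    fix q assume "q \<in> P"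
    then have "{p\<in>P. c q \<le> c p} \<noteq> {}" by blast
    then show "rk q \<in> {1..card P}"
      using P by (auto simp: rk_def Suc_le_eq card_gt_0_iff intro!: card_mono)
  qed
  ultimately have "rk ` P = {1..card P}"
    by (intro card_subset_eq) (auto simp: card_image)
  then have "r \<in> rk ` P" using r by simp
  then show ?thesis using that by (auto simp: rk_def)
qed

text \<open>Cutting at the height of \<open>x\<close> leaves a point of each part weakly above, and
  weakly below traces to which induction applies. At most one point is counted twice, so the bound
  grows by \<open>card Q - 1\<close>.\<close>

lemma card_lower_bound:
  assumes "finite P" "stair_general_position d P" "partition_on P Q" "Q \<noteq> {}"
    and "\<And>A. A \<in> Q \<Longrightarrow> all_types d A x"
  shows "(card Q - 1) * (d + 1) + 1 \<le> card P"
  using assms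
proof (induction d arbitrary: P Q)
  case 0
  have "P \<inter> A \<noteq> {}" if "A \<in> Q" for A
  proof -
    have "A \<noteq> {}" "A \<subseteq> P" using 0(3) that by (auto simp: partition_on_def)
    then show ?thesis by blast
  qed
  then have "card Q \<le> card P" by (intro card_le_of_hits[OF 0(3,1)]) auto
  moreover have "card Q > 0" using 0 finite_elements[of P Q] by (simp add: card_gt_0_iff)
  ultimately show ?case by simp
next
  case (Suc d)
  define L where "L = {p\<in>P. p (Suc d) \<le> x (Suc d)}"
  define U where "U = {p\<in>P. x (Suc d) \<le> p (Suc d)}"
  have AP: "A \<subseteq> P" if "A \<in> Q" for A using that Suc.prems(3) by (auto simp: partition_on_def)
  have LA: "all_types d (L \<inter> A) x" if "A \<in> Q" for A
  proof -
    have "{a\<in>A. a (Suc d) \<le> x (Suc d)} \<subseteq> L \<inter> A" using AP[OF that] by (auto simp: L_def)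
    with Suc.prems(5)[OF that] show ?thesis unfolding all_types_Suc by (auto elim: all_types_mono)
  qed
  have UA: "U \<inter> A \<noteq> {}" if "A \<in> Q" for A
    using Suc.prems(5)[OF that] AP[OF that] by (auto simp: all_types_Suc U_def)
  have fin: "finite L" "finite U" using Suc.prems(1) by (auto simp: L_def U_def)
  have trace: "partition_on L ((\<inter>) L ` Q)" "inj_on ((\<inter>) L) Q"
    using partition_on_trace[OF Suc.prems(3), of L] all_types_nonempty[OF LA] by (auto simp: L_def)
  have "(card ((\<inter>) L ` Q) - 1) * (d + 1) + 1 \<le> card L"
    using Suc.prems LA fin trace stair_general_position_mono[OF Suc.prems(2), of d L]
    by (intro Suc.IH) (auto simp: L_def)
  then have lower: "(card Q - 1) * (d + 1) + 1 \<le> card L" using trace by (simp add: card_image)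
  \<comment> \<open>Points of \<open>U \<inter> L\<close> share the last coordinate of
    \<open>x\<close>, which general position allows for one point only.\<close>
  have "p = s" if "p \<in> U \<inter> L" "s \<in> U \<inter> L" for p s
  proof (rule ccontr)
    assume "p \<noteq> s"
    then have "p (Suc d) \<noteq> s (Suc d)"
      using Suc.prems(2) that by (auto simp: stair_general_position_def U_def)
    then show False using that by (auto simp: U_def L_def)
  qed
  then have "card (U \<inter> L) \<le> 1" using fin by (simp add: card_le_Suc0_iff_eq)
  moreover have "card Q \<le> card U" using card_le_of_hits[OF Suc.prems(3) fin(2) UA] .
  moreover have "U \<union> L = P" by (auto simp: U_def L_def)
  then have "card U + card L = card P + card (U \<inter> L)" using card_Un_Int[OF fin(2,1)] by simp
  \<comment> \<open>This keeps the subtraction in \<open>card Q - 1\<close> from being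
    truncated.\<close>
  moreover have "card Q > 0" using Suc.prems finite_elements[of P Q] by (simp add: card_gt_0_iff)
  ultimately show ?case using lower by (cases "card Q") (auto simp: algebra_simps)
qed

text \<open>The last coordinate of a common point is forced: it has \<open>r\<close> points weakly above it, one in
  each part, and by \<open>card_lower_bound\<close> enough points weakly below it.\<close>

lemma common_all_types_Suc:
  assumes P: "finite P" "stair_general_position (Suc d) P"
    and q: "q \<in> P" "card U = r"
    and U: "U = {p\<in>P. q (Suc d) \<le> p (Suc d)}" and L: "L = {p\<in>P. p (Suc d) \<le> q (Suc d)}"
    and cL: "card L = (r - 1) * (d + 1) + 1"
    and Q: "partition_on P Q" "card Q = r" "Q \<noteq> {}"
  shows "common_all_types (Suc d) Q \<longleftrightarrow>
    (\<forall>A\<in>Q. U \<inter> A \<noteq> {}) \<and> common_all_types d ((\<inter>) L ` Q)"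
proof
  assume "common_all_types (Suc d) Q"
  then obtain x where x: "\<And>A. A \<in> Q \<Longrightarrow> all_types (Suc d) A x"
    by (auto simp: common_all_types_def)
  have AP: "A \<subseteq> P" if "A \<in> Q" for A using that Q(1) by (auto simp: partition_on_def)
  define X where "X = {p\<in>P. x (Suc d) \<le> p (Suc d)}"
  define Y where "Y = {p\<in>P. p (Suc d) \<le> x (Suc d)}"
  have fin: "finite X" "finite Y" "finite U" "finite L" using P U L by (auto simp: X_def Y_def)
  have XA: "X \<inter> A \<noteq> {}" if "A \<in> Q" for A
    using x[OF that] AP[OF that] by (auto simp: all_types_Suc X_def)
  have YA: "all_types d (Y \<inter> A) x" if "A \<in> Q" for A
  proof -
    have "{a\<in>A. a (Suc d) \<le> x (Suc d)} \<subseteq> Y \<inter> A" using AP[OF that] by (auto simp: Y_def)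
    with x[OF that] show ?thesis unfolding all_types_Suc by (auto elim: all_types_mono)
  qed
  have "x (Suc d) \<le> q (Suc d)"
  proof (rule ccontr)
    assume "\<not> ?thesis"
    \<comment> \<open>The point \<open>q\<close> is lost, leaving fewer than \<open>r\<close> points
      for \<open>r\<close> parts.\<close>
    then have "X \<subset> U" using q U by (auto simp: X_def)
    then have "card X < r" using psubset_card_mono[OF fin(3)] q by blast
    then show False using card_le_of_hits[OF Q(1) fin(1) XA] Q(2) by simp
  qed
  moreover have "q (Suc d) \<le> x (Suc d)"
  proof (rule ccontr)
    assume "\<not> ?thesis"
    \<comment> \<open>Again \<open>q\<close> is lost, and too few points remain for the lower
      bound.\<close>
    then have "Y \<subset> L" using q L by (auto simp: Y_def)
    then have "card Y < (r - 1) * (d + 1) + 1" using psubset_card_mono[OF fin(4)] cL by metis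
    moreover have trace: "partition_on Y ((\<inter>) Y ` Q)" "inj_on ((\<inter>) Y) Q"
      using partition_on_trace[OF Q(1), of Y] all_types_nonempty[OF YA] by (auto simp: Y_def)
    moreover have "(card ((\<inter>) Y ` Q) - 1) * (d + 1) + 1 \<le> card Y"
      using Q YA fin trace stair_general_position_mono[OF P(2), of d Y]
      by (intro card_lower_bound) (auto simp: Y_def)
    ultimately show False using Q(2) by (simp add: card_image)
  qed
  ultimately have eq: "x (Suc d) = q (Suc d)" by simp
  then have "X = U" "Y = L" by (auto simp: X_def Y_def U L)
  then show "(\<forall>A\<in>Q. U \<inter> A \<noteq> {}) \<and> common_all_types d ((\<inter>) L ` Q)"
    using XA YA unfolding common_all_types_def by blast
next
  assume "(\<forall>A\<in>Q. U \<inter> A \<noteq> {}) \<and> common_all_types d ((\<inter>) L ` Q)"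
  then obtain x where UA: "\<And>A. A \<in> Q \<Longrightarrow> U \<inter> A \<noteq> {}"
    and x: "\<And>A. A \<in> Q \<Longrightarrow> all_types d (L \<inter> A) x" by (auto simp: common_all_types_def)
  \<comment> \<open>Lifting to the height of \<open>q\<close> makes \<open>L\<close> the points
    weakly below and \<open>U\<close> those weakly above.\<close>
  define y where "y = x(Suc d := q (Suc d))"
  have "all_types (Suc d) A y" if "A \<in> Q" for A
  proof -
    have "all_types d (L \<inter> A) y" using x[OF that] all_types_cong[of d x y] by (simp add: y_def)
    moreover have "L \<inter> A \<subseteq> {a\<in>A. a (Suc d) \<le> y (Suc d)}" by (auto simp: L y_def)
    ultimately have "all_types d {a\<in>A. a (Suc d) \<le> y (Suc d)} y" by (rule all_types_mono)
    then show ?thesis using UA[OF that] unfolding all_types_Suc by (auto simp: U y_def)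
  qed
  then show "common_all_types (Suc d) Q" by (auto simp: common_all_types_def)
qed

section \<open>The count\<close>

text \<open>Sending a point to its part is onto, hence injective by cardinality. This settles
  dimension 0.\<close>

lemma partition_on_card_eq:
  assumes "finite P"
  shows "partition_on P Q \<and> card Q = card P \<longleftrightarrow> Q = (\<lambda>p. {p}) ` P"
proof
  assume "Q = (\<lambda>p. {p}) ` P"
  then show "partition_on P Q \<and> card Q = card P"
    by (simp add: partition_on_singletons card_image)
next
  assume Q: "partition_on P Q \<and> card Q = card P"
  have "\<forall>u\<in>P. \<exists>A\<in>Q. u \<in> A" using Q by (auto simp: partition_on_def)
  then obtain h where h: "\<And>u. u \<in> P \<Longrightarrow> h u \<in> Q" "\<And>u. u \<in> P \<Longrightarrow> u \<in> h u" by metis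
  have hu: "h u = A" if "A \<in> Q" "u \<in> A" for u A
    using partition_on_part_unique[of P Q] Q h that by (metis UnionI partition_on_def)
  have im: "h ` P = Q"
  proof
    show "Q \<subseteq> h ` P"
    proof
      fix A assume "A \<in> Q"
      moreover from this obtain u where "u \<in> A" using Q by (metis equals0I partition_on_def)
      ultimately show "A \<in> h ` P" using hu Q by (metis UnionI image_eqI partition_on_def)
    qed
  qed (use h in auto)
  then have inj: "inj_on h P" using assms Q by (intro eq_card_imp_inj_on) auto
  have "h u = {u}" if "u \<in> P" for u
  proof -
    have "v = u" if "v \<in> h u" for v
    proof -
      have "v \<in> P" using that h \<open>u \<in> P\<close> Q by (auto simp: partition_on_def)
      then show ?thesis using hu[of "h u" v] that h \<open>u \<in> P\<close> inj by (auto dest: inj_onD)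
    qed
    then show ?thesis using h that by blast
  qed
  then show "Q = (\<lambda>p. {p}) ` P" using im by auto
qed

text \<open>Points keep their higher coordinates when the dimension drops. Projecting them would
  merge the \<open>r\<close> points left in dimension 0, where the induction starts.\<close>

lemma card_common_all_types:
  assumes "1 \<le> r" "finite P" "stair_general_position d P" "card P = (r - 1) * (d + 1) + 1"
  shows "card {Q. partition_on P Q \<and> card Q = r \<and> common_all_types d Q} = fact (r - 1) ^ d"
  using assms
proof (induction d arbitrary: P)
  case 0
  then have "card P = r" by simp
  then have "partition_on P Q \<and> card Q = r \<longleftrightarrow> Q = (\<lambda>p. {p}) ` P" for Q
    using partition_on_card_eq[OF 0(2), of Q] by simp
  moreover have "common_all_types 0 ((\<lambda>p. {p}) ` P)"
    by (auto simp: common_all_types_def all_types_def stair_type_def)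
  ultimately have "{Q. partition_on P Q \<and> card Q = r \<and> common_all_types 0 Q} = {(\<lambda>p. {p}) ` P}"
    by blast
  then show ?case by simp
next
  case (Suc d)
  have inj: "inj_on (\<lambda>p. p (Suc d)) P"
    using Suc.prems(3) by (force simp: stair_general_position_def inj_on_def)
  have "r \<le> card P" using Suc.prems by (cases r) auto
  with inj Suc.prems(1,2) obtain q where q: "q \<in> P" "card {p\<in>P. q (Suc d) \<le> p (Suc d)} = r"
    using exists_rank[of P "\<lambda>p. p (Suc d)" r] by blast
  define U where "U = {p\<in>P. q (Suc d) \<le> p (Suc d)}"
  define L where "L = {p\<in>P. p (Suc d) \<le> q (Suc d)}"
  have UL: "U \<union> L = P" "U \<inter> L = {q}"
    using inj q(1) by (auto simp: U_def L_def inj_on_def)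
  have fin: "finite U" "finite L" using Suc.prems(2) by (auto simp: U_def L_def)
  \<comment> \<open>The summand 1 is \<open>q\<close>, which lies in both \<open>U\<close> and
    \<open>L\<close>.\<close>
  have "r + card L = card P + 1" using card_Un_Int[OF fin] UL q by (simp add: U_def)
  then have cL: "card L = (r - 1) * (d + 1) + 1"
    using Suc.prems(1,4) by (cases r) (auto simp: algebra_simps)
  define G where "G = {Q. partition_on L Q \<and> card Q = r \<and> common_all_types d Q}"
  have "card G = fact (r - 1) ^ d"
    unfolding G_def using Suc.prems(1) fin(2) cL stair_general_position_mono[OF Suc.prems(3), of d L]
    by (intro Suc.IH) (auto simp: L_def)
  moreover have "partition_on P Q \<and> card Q = r \<and> common_all_types (Suc d) Q \<longleftrightarrow>
    partition_on P Q \<and> card Q = r \<and> (\<forall>A\<in>Q. U \<inter> A \<noteq> {}) \<and> (\<inter>) L ` Q \<in> G" for Q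
  proof (cases "partition_on P Q \<and> card Q = r")
    case True
    then have "Q \<noteq> {}" using Suc.prems(1) by auto
    have "partition_on L ((\<inter>) L ` Q) \<and> card ((\<inter>) L ` Q) = r" if "common_all_types d ((\<inter>) L ` Q)"
    proof -
      have "L \<inter> A \<noteq> {}" if "A \<in> Q" for A
        using \<open>common_all_types d _\<close> that all_types_nonempty by (auto simp: common_all_types_def)
      then show ?thesis using partition_on_trace[of P Q L] True UL by (auto simp: card_image)
    qed
    then show ?thesis
      using common_all_types_Suc[of P d q U r L Q] Suc.prems q cL True \<open>Q \<noteq> {}\<close> U_def L_def
      unfolding G_def by auto
  qed auto
  moreover have cU: "card U = r" using q by (simp add: U_def)
  moreover have GL: "G \<subseteq> {Q'. partition_on L Q' \<and> card Q' = r}" by (auto simp: G_def)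
  ultimately show ?case using card_extensions[OF Suc.prems(2) cU UL GL] by simp
qed

theorem corollary4p12:
  fixes d r :: nat and P :: "point set"
  assumes "d \<ge> 1" and "r \<ge> 1"
    and "P \<subseteq> Rspace d"
    and "card P = (r - 1) * (d + 1) + 1"
    and "stair_general_position d P"
  shows "card {Q. stair_Tverberg_partition d r P Q} = (fact (r - 1)) ^ d"
proof -
  \<comment> \<open>An infinite set would have cardinality 0, but the prescribed one is
    positive.\<close>
  have "finite P" using assms(4) by (simp add: card_ge_0_finite)
  then show ?thesis
    using card_common_all_types assms by (simp add: stair_Tverberg_partition_iff)
qed

end
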